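(* Let $f\colon\mathbb{R}^d\to\mathbb{R}$ be convex and differentiable with locally Lipschitz gradient $\nabla f$, and suppose $f$ has a minimizer. Let $f_*=\min f$, let $\alpha_0>0$, $x^0\in\mathbb{R}^d$, and let $(x^k)$ and $(\alpha_k)$ be generated by the adaptive gradient descent algorithm described in the context. Then $(x^k)$ converges to a minimizer of $f$. Moreover, for every minimizer $x^*$ of $f$, with $R\ge 0$ defined by $$R^2=\|x^0-x^*\|^2+2\alpha_0^2\|\nabla f(x^0)\|^2+\alpha_0\,(f(x^0)-f_* ),$$ for all $k\ge1$ we have $$\min_{1\le i\le k}\bigl(f(x^i)-f_*\bigr)\le\frac{R^2}{2\sum_{i=1}^k\alpha_i}.$$ In particular, if $\alpha_0$ is such that $\alpha_0L_1\in\left[\frac1{\sqrt2},2\right]$, then for all $k\ge1$ $$\min_{1\le i\le k}\bigl(f(x^i)-f_*\bigr)\le\frac{LR^2}{\sqrt2\,k},$$ where $L$ is the Lipschitz constant of $\nabla f$ over the closed ball $B(x^*,R)$.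
   Context: $\|\cdot\|$ is the Euclidean norm and $[t]_+=\max\{t,0\}$. A map is locally Lipschitz if it is Lipschitz on every compact subset of its domain. Algorithm (adaptive gradient descent): given $x^0\in\mathbb{R}^d$, $\theta_0=\frac13$, $\alpha_0>0$, set $x^1=x^0-\alpha_0\nabla f(x^0)$, and for $k=1,2,\dots$ $$L_k=\frac{\|\nabla f(x^k)-\nabla f(x^{k-1})\|}{\|x^k-x^{k-1}\|},\qquad \alpha_k=\min\left\{\sqrt{\tfrac23+\theta_{k-1}}\;\alpha_{k-1},\ \frac{\alpha_{k-1}}{\sqrt{[2\alpha_{k-1}^2L_k^2-1]_+}}\right\},$$ $$x^{k+1}=x^k-\alpha_k\nabla f(x^k),\qquad \theta_k=\frac{\alpha_k}{\alpha_{k-1}},$$ with the convention $\frac a0=+\infty$ for $a>0$. It is assumed that $x^k\ne x^{k-1}$ for all $k\ge1$, so that every $L_k$ is well defined (otherwise $x^{k-1}$ is already a minimizer and the algorithm stops). *)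

theory Defs
  imports "HOL-Analysis.Analysis"
begin

definition minimizer :: "('a \<Rightarrow> real) \<Rightarrow> 'a \<Rightarrow> bool" where
  "minimizer f z \<longleftrightarrow> (\<forall>y. f z \<le> f y)"

text \<open>Lipschitz on every compact set; the library's \<open>local_lipschitz\<close> is instead a
  neighbourhood-based notion for families of maps.\<close>

definition locally_lipschitz :: "('a::metric_space \<Rightarrow> 'b::metric_space) \<Rightarrow> bool" where
  "locally_lipschitz g \<longleftrightarrow> (\<forall>K. compact K \<longrightarrow> (\<exists>C. C-lipschitz_on K g))"

text \<open>The least Lipschitz constant of \<open>g\<close> on \<open>S\<close>; meaningful only if \<open>g\<close> is Lipschitz
  on \<open>S\<close>, since otherwise the infimum is taken over the empty set.\<close>

definition lipschitz_const :: "'a::metric_space set \<Rightarrow> ('a \<Rightarrow> 'b::metric_space) \<Rightarrow> real" where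
  "lipschitz_const S g = Inf {C. C-lipschitz_on S g}"

text \<open>The quantity \<open>L\<^sub>k\<close> of the algorithm, for a gradient map \<open>g\<close>, iterates \<open>x\<close> and \<open>k \<ge> 1\<close>.\<close>

definition local_curvature ::
    "('a::real_normed_vector \<Rightarrow> 'a) \<Rightarrow> (nat \<Rightarrow> 'a) \<Rightarrow> nat \<Rightarrow> real" where
  "local_curvature g x k = norm (g (x k) - g (x (k - 1))) / norm (x k - x (k - 1))"

text \<open>\<open>x\<close>, \<open>\<alpha>\<close>, \<open>\<theta>\<close> are the iterates, step sizes and step-size ratios of adaptive gradient
  descent started at \<open>x 0\<close> with initial step size \<open>\<alpha> 0\<close>. The minimum is taken in \<open>ereal\<close>,
  where \<open>a / 0 = \<infinity>\<close> for \<open>a > 0\<close>, whereas division by zero in \<open>real\<close> yields \<open>0\<close>.\<close>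

definition adaptive_gd ::
    "('a::real_normed_vector \<Rightarrow> 'a) \<Rightarrow> (nat \<Rightarrow> 'a) \<Rightarrow> (nat \<Rightarrow> real) \<Rightarrow> (nat \<Rightarrow> real) \<Rightarrow> bool" where
  "adaptive_gd g x \<alpha> \<theta> \<longleftrightarrow>
     \<theta> 0 = 1 / 3 \<and>
     x 1 = x 0 - \<alpha> 0 *\<^sub>R g (x 0) \<and>
     (\<forall>k\<ge>1.
        ereal (\<alpha> k) =
          min (ereal (sqrt (2 / 3 + \<theta> (k - 1)) * \<alpha> (k - 1)))
              (ereal (\<alpha> (k - 1)) /
               ereal (sqrt (max (2 * (\<alpha> (k - 1))\<^sup>2 * (local_curvature g x k)\<^sup>2 - 1) 0))) \<and>
        x (k + 1) = x k - \<alpha> k *\<^sub>R g (x k) \<and>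
        \<theta> k = \<alpha> k / \<alpha> (k - 1))"

end

theory Submission
  imports Defs
begin

text \<open>Let \<open>z\<close> be a minimizer and put \<open>F\<^sub>k = f (x k) - f z\<close>. The step-size rule
  \<open>\<alpha>\<^sub>k\<^sup>2 (2 \<alpha>\<^sub>k\<^sub>-\<^sub>1\<^sup>2 L\<^sub>k\<^sup>2 - 1) \<le> \<alpha>\<^sub>k\<^sub>-\<^sub>1\<^sup>2\<close> bounds \<open>2 \<alpha>\<^sub>k\<^sup>2 |g\<^sub>k|\<^sup>2\<close> by
  \<open>\<alpha>\<^sub>k\<^sub>-\<^sub>1\<^sup>2 |g\<^sub>k\<^sub>-\<^sub>1|\<^sup>2 + 3 \<alpha>\<^sub>k \<theta>\<^sub>k (F\<^sub>k\<^sub>-\<^sub>1 - F\<^sub>k)\<close>, so that the energy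
  \<open>|x\<^sub>k\<^sub>+\<^sub>1 - z|\<^sup>2 + \<alpha>\<^sub>k\<^sup>2 |g\<^sub>k|\<^sup>2 + \<alpha>\<^sub>k (2 + 3 \<theta>\<^sub>k) F\<^sub>k\<close> decreases; this is exactly where
  \<open>\<theta>\<^sub>k\<^sup>2 \<le> 2/3 + \<theta>\<^sub>k\<^sub>-\<^sub>1\<close> is needed. Telescoping gives the first rate and keeps the iterates in
  the ball of radius \<open>R\<close>, where \<open>L\<^sub>k \<le> L\<close>. The second rate follows since the step sizes average
  at least \<open>1 / (sqrt 2 L)\<close>. For convergence, step sizes bounded away from zero and the
  co-coercivity of the gradient force \<open>g\<^sub>k \<rightarrow> 0\<close>, so all cluster points are minimizers, and an
  Opial argument with the energies of two minimizers shows that there is only one.\<close>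

section \<open>Convexity and the gradient\<close>

text \<open>Restricting \<open>f\<close> to the line through \<open>u\<close> and \<open>v\<close>
  reduces this to the tangent inequality on the reals.\<close>

lemma convex_gradient_le:
  fixes f :: "'a::real_inner \<Rightarrow> real"
  assumes "convex_on UNIV f" "GDERIV f u :> d"
  shows "f u + inner d (v - u) \<le> f v"
proof -
  define \<phi> where "\<phi> t = f (u + t *\<^sub>R (v - u))" for t :: real
  have "convex_on UNIV \<phi>"
  proof (rule convex_onI)
    fix t a b :: real
    assume t: "0 < t" "t < 1"
    have "u + ((1 - t) *\<^sub>R a + t *\<^sub>R b) *\<^sub>R (v - u)
        = (1 - t) *\<^sub>R (u + a *\<^sub>R (v - u)) + t *\<^sub>R (u + b *\<^sub>R (v - u))"
      by (simp add: algebra_simps)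
    then show "\<phi> ((1 - t) *\<^sub>R a + t *\<^sub>R b) \<le> (1 - t) * \<phi> a + t * \<phi> b"
      unfolding \<phi>_def using convex_onD[OF assms(1), of t] t by auto
  qed auto
  moreover have "(\<phi> has_real_derivative inner d (v - u)) (at 0)"
  proof -
    have line: "((\<lambda>t. u + t *\<^sub>R (v - u)) has_derivative (\<lambda>t. t *\<^sub>R (v - u))) (at 0)"
      by (auto intro!: derivative_eq_intros)
    have "(f has_derivative (\<lambda>h. inner h d)) (at (u + 0 *\<^sub>R (v - u)))"
      using assms(2) by (simp add: gderiv_def)
    from has_derivative_compose[OF line this] show ?thesis
      by (simp add: \<phi>_def[abs_def] has_field_derivative_def inner_commute mult_commute_abs)
  qed
  ultimately have "\<phi> 1 - \<phi> 0 \<ge> inner d (v - u) * (1 - 0)"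
    by (intro convex_on_imp_above_tangent[where A = UNIV]) auto
  then show ?thesis by (simp add: \<phi>_def)
qed

lemma gderiv_imp_continuous:
  assumes "GDERIV f u :> d"
  shows "isCont f u"
  using assms has_derivative_continuous by (auto simp: gderiv_def)

lemma minimizer_eq_INF:
  assumes "minimizer f z"
  shows "f z = (INF y. f y)"
proof (rule antisym)
  show "f z \<le> (INF y. f y)"
    using assms by (intro cINF_greatest) (auto simp: minimizer_def)
  show "(INF y. f y) \<le> f z"
    using assms by (intro cINF_lower) (auto simp: minimizer_def bdd_below_def)
qed

text \<open>Evaluating \<open>f\<close> at \<open>z + g u / (2 C)\<close>, once from below by the tangent at \<open>u\<close> and once from
  above by convexity and the Lipschitz bound near \<open>z\<close>.\<close>

lemma convex_gradient_gap:
  fixes f :: "'a::real_inner \<Rightarrow> real"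
  assumes conv: "convex_on UNIV f" and grad: "\<And>y. GDERIV f y :> g y"
    and lip: "C-lipschitz_on (cball z r) g" and C: "C > 0"
    and gz: "g z = 0" and u: "u \<in> cball z r"
  shows "(norm (g u))\<^sup>2 / (4 * C) \<le> inner (g u) (u - z) - (f u - f z)"
proof -
  \<comment> \<open>The two bounds give the gap at least
    \<open>(s - C * s^2) * (norm (g u))^2\<close>; this \<open>s\<close> maximizes the factor and
    keeps \<open>z + s *\<^sub>R g u\<close> in the ball.\<close>
  define s where "s = 1 / (2 * C)"
  have s: "s > 0" "s * C = 1 / 2"
    using C by (simp_all add: s_def)
  define v where "v = s *\<^sub>R g u"
  have r: "r \<ge> 0"
    using u zero_le_dist[of z u] by (simp del: zero_le_dist)
  have "norm (g u) \<le> C * dist u z"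
    using lipschitz_onD[OF lip u, of z] r gz by (simp add: dist_norm)
  then have "norm v \<le> s * (C * dist u z)"
    using s by (simp add: v_def)
  also have "\<dots> = 1 / 2 * dist u z"
    using s(2) by (simp flip: mult.assoc)
  also have "\<dots> \<le> r"
    using u r by (simp add: dist_commute)
  finally have "z + v \<in> cball z r"
    by (simp add: dist_norm)
  then have "norm (g (z + v)) \<le> C * norm v"
    using lipschitz_onD[OF lip, of "z + v" z] r gz by (simp add: dist_norm)
  then have "inner (g (z + v)) v \<le> C * (norm v)\<^sup>2"
    using norm_cauchy_schwarz[of "g (z + v)" v] mult_right_mono[of _ _ "norm v"]
    by (fastforce simp: power2_eq_square mult.assoc)
  moreover have "f (z + v) - f z \<le> inner (g (z + v)) v"
    using convex_gradient_le[OF conv grad, of "z + v" z] by simp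
  moreover have "f u + inner (g u) (z + v - u) \<le> f (z + v)"
    by (rule convex_gradient_le[OF conv grad])
  moreover have "inner (g u) (z + v - u) = s * (norm (g u))\<^sup>2 - inner (g u) (u - z)"
    by (simp add: v_def inner_diff_right inner_add_right power2_norm_eq_inner)
  moreover have "C * (norm v)\<^sup>2 = s / 2 * (norm (g u))\<^sup>2"
    using s by (simp add: v_def power_mult_distrib power2_eq_square mult.commute)
  ultimately have "s / 2 * (norm (g u))\<^sup>2 \<le> inner (g u) (u - z) - (f u - f z)"
    by simp
  then show ?thesis by (simp add: s_def)
qed

section \<open>Lower bounds for step-size sequences\<close>

lemma sqrt_two_thirds_ge:
  assumes "t \<ge> 0"
  shows "4 / 5 \<le> sqrt (2 / 3 + t)"
  using assms by (intro real_le_rsqrt) (simp add: power2_eq_square)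

lemma sqrt_two_thirds_ge':
  assumes "t \<ge> 4 / 5"
  shows "6 / 5 \<le> sqrt (2 / 3 + t)"
  using assms by (intro real_le_rsqrt) (simp add: power2_eq_square)

text \<open>Only a scaled step can fall below \<open>m\<close>. The factor of the first such step is
  at least 4/5 and becomes the new ratio; from then on the factors are at least 6/5, so the steps
  grow as long as they stay below \<open>m\<close>.\<close>

lemma step_sizes_lower_bound:
  fixes a \<theta> :: "nat \<Rightarrow> real"
  assumes m: "m > 0" and a0: "m \<le> a 0" and a: "\<And>k. a k > 0" and \<theta>: "\<And>k. \<theta> k > 0"
    and ratio: "\<And>k. \<theta> (Suc k) = a (Suc k) / a k"
    and step: "\<And>k. a (Suc k) = sqrt (2 / 3 + \<theta> k) * a k \<or> m \<le> a (Suc k)"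
  shows "4 / 5 * m \<le> a k"
proof -
  have "m \<le> a k \<or> 4 / 5 * m \<le> a k \<and> 4 / 5 \<le> \<theta> k"
  proof (induction k)
    case 0
    then show ?case using a0 by simp
  next
    case (Suc k)
    show ?case
    proof (cases "m \<le> a (Suc k)")
      case False
      then have eq: "a (Suc k) = sqrt (2 / 3 + \<theta> k) * a k"
        using step[of k] by simp
      then have \<theta>eq: "\<theta> (Suc k) = sqrt (2 / 3 + \<theta> k)"
        using ratio a[of k] by simp
      have ge: "4 / 5 \<le> sqrt (2 / 3 + \<theta> k)"
        using \<theta>[of k] by (intro sqrt_two_thirds_ge) simp
      from Suc have "4 / 5 * m \<le> sqrt (2 / 3 + \<theta> k) * a k"
      proof
        assume "m \<le> a k"
        then show ?thesis using ge m \<theta>[of k] by (intro mult_mono) auto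
      next
        assume *: "4 / 5 * m \<le> a k \<and> 4 / 5 \<le> \<theta> k"
        then have "6 / 5 * (4 / 5 * m) \<le> sqrt (2 / 3 + \<theta> k) * a k"
          using sqrt_two_thirds_ge'[of "\<theta> k"] m by (intro mult_mono) auto
        then show ?thesis using m by simp
      qed
      then show ?thesis using ge eq \<theta>eq by simp
    qed simp
  qed
  then show ?thesis using m by auto
qed

text \<open>A single step may fall below \<open>c\<close>, but only after a drop by a factor of more than 3; the
  step before that drop exceeds \<open>3 c\<close> and pays for the at most two short steps that follow.
  The alternatives of the invariant in the proof are: no drop, right after a drop, and the first
  and the second short step.\<close>

lemma step_sizes_sum_lower_bound:
  fixes a \<theta> :: "nat \<Rightarrow> real"
  assumes c: "c > 0" and a: "\<And>k. a k > 0" and \<theta>: "\<And>k. \<theta> k > 0"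
    and ratio: "\<And>k. \<theta> (Suc k) = a (Suc k) / a k"
    and step: "\<And>k. a (Suc k) = sqrt (2 / 3 + \<theta> k) * a k \<or> c \<le> a (Suc k)"
    and a1: "c \<le> a 1" and \<theta>1: "1 / 3 \<le> \<theta> 1"
  shows "real k * c \<le> (\<Sum>i=1..k. a i)"
proof -
  define S where "S k = (\<Sum>i=1..k. a i)" for k
  have S_Suc: "S (Suc k) = S k + a (Suc k)" for k
    by (simp add: S_def)
  have inv: "real k * c \<le> S k \<and> real (Suc k) * c \<le> S (Suc k) \<and>
      (c \<le> a (Suc k) \<and> 1 / 3 \<le> \<theta> (Suc k) \<or>
       c \<le> a (Suc k) \<and> real (k + 3) * c \<le> S (Suc k) \<or>
       4 / 5 * c \<le> a (Suc k) \<and> 4 / 5 \<le> \<theta> (Suc k) \<and> real (k + 2) * c \<le> S (Suc k) \<or>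
       19 / 20 * c \<le> a (Suc k) \<and> 6 / 5 \<le> \<theta> (Suc k) \<and> (real k + 3 / 2) * c \<le> S (Suc k))" for k
  proof (induction k)
    case 0
    then show ?case using a1 \<theta>1 by (simp add: S_def)
  next
    case (Suc k)
    note S1 = S_Suc[of k] and S2 = S_Suc[of "Suc k"]
    define q where "q = sqrt (2 / 3 + \<theta> (Suc k))"
    show ?case
    proof (cases "c \<le> a (Suc (Suc k))")
      case True
      show ?thesis
      proof (cases "1 / 3 \<le> \<theta> (Suc (Suc k))")
        case True
        with \<open>c \<le> a (Suc (Suc k))\<close> Suc show ?thesis
          unfolding S2 by (auto simp: algebra_simps)
      next
        case False
        \<comment> \<open>After a drop the previous step is at least \<open>3 * c\<close>; added to
          \<open>S k\<close>, whose bound the invariant carries for this purpose, it leaves two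
          units of \<open>c\<close> in reserve.\<close>
        then have "3 * a (Suc (Suc k)) \<le> a (Suc k)"
          using a[of "Suc k"] by (simp add: ratio field_simps)
        with \<open>c \<le> a (Suc (Suc k))\<close> Suc show ?thesis
          unfolding S2 S1 by (auto simp: algebra_simps)
      qed
    next
      case False
      then have eq: "a (Suc (Suc k)) = q * a (Suc k)"
        using step[of "Suc k"] by (simp add: q_def)
      then have \<theta>eq: "\<theta> (Suc (Suc k)) = q"
        using ratio a[of "Suc k"] by simp
      have q: "4 / 5 \<le> q"
        unfolding q_def using \<theta>[of "Suc k"] by (intro sqrt_two_thirds_ge) simp
      from Suc consider
          (good) "c \<le> a (Suc k)" "1 / 3 \<le> \<theta> (Suc k)"
        | (drop) "c \<le> a (Suc k)" "real (k + 3) * c \<le> S (Suc k)"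
        | (low) "4 / 5 * c \<le> a (Suc k)" "4 / 5 \<le> \<theta> (Suc k)" "real (k + 2) * c \<le> S (Suc k)"
        | (rec) "19 / 20 * c \<le> a (Suc k)" "6 / 5 \<le> \<theta> (Suc k)"
        by blast
      then show ?thesis
      proof cases
        case good
        \<comment> \<open>The ratio 1/3 is where \<open>2 / 3 + \<theta>\<close> reaches 1: without
          a preceding drop a scaled step does not shrink.\<close>
        then have "1 \<le> q" unfolding q_def by (intro real_le_rsqrt) simp
        then have "1 * c \<le> q * a (Suc k)" using good c by (intro mult_mono) auto
        then show ?thesis using False eq by simp
      next
        case drop
        have "4 / 5 * c \<le> q * a (Suc k)" using drop q c by (intro mult_mono) auto
        then show ?thesis using drop q c Suc unfolding S2 eq \<theta>eq by (auto simp: algebra_simps)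
      next
        case low
        \<comment> \<open>The second short step is at least 6/5 * 4/5 = 24/25 of \<open>c\<close>,
          hence 19/20 of it. The next factor is at least 4/3, and 4/3 * 19/20 > 1 rules out a third
          short step.\<close>
        have q': "6 / 5 \<le> q" unfolding q_def by (rule sqrt_two_thirds_ge'[OF low(2)])
        then have "6 / 5 * (4 / 5 * c) \<le> q * a (Suc k)" using low c by (intro mult_mono) auto
        then show ?thesis using low q' c Suc unfolding S2 eq \<theta>eq by (auto simp: algebra_simps)
      next
        case rec
        then have "4 / 3 \<le> q"
          unfolding q_def by (intro real_le_rsqrt) (simp add: power2_eq_square)
        then have "4 / 3 * (19 / 20 * c) \<le> q * a (Suc k)" using rec c by (intro mult_mono) auto
        then show ?thesis using False eq c by simp
      qed
    qed
  qed
  from inv[of k] show ?thesis by (simp add: S_def)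
qed

section \<open>Bounded sequences with a single cluster point\<close>

lemma bounded_unique_cluster_imp_tendsto:
  fixes x :: "nat \<Rightarrow> 'a::heine_borel"
  assumes "bounded (range x)"
    and uniq: "\<And>r y. strict_mono r \<Longrightarrow> (x \<circ> r) \<longlonglongrightarrow> y \<Longrightarrow> y = z"
  shows "x \<longlonglongrightarrow> z"
proof (rule ccontr)
  assume "\<not> x \<longlonglongrightarrow> z"
  then obtain e where e: "e > 0" "\<not> (\<forall>\<^sub>F n in sequentially. dist (x n) z < e)"
    by (auto simp: tendsto_iff)
  then have "infinite {n. \<not> dist (x n) z < e}"
    by (simp add: frequently_cofinite[symmetric] cofinite_eq_sequentially frequently_def)
  then obtain r :: "nat \<Rightarrow> nat" where r: "strict_mono r" "\<And>n. e \<le> dist (x (r n)) z"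
    by (auto dest!: infinite_enumerate simp: not_less)
  have "bounded (range (x \<circ> r))"
    using assms(1) by (rule bounded_subset) auto
  then obtain y s where s: "strict_mono s" "((x \<circ> r) \<circ> s) \<longlonglongrightarrow> y"
    using bounded_imp_convergent_subsequence by blast
  then have "((x \<circ> (r \<circ> s)) \<longlonglongrightarrow> z)"
    using uniq[of "r \<circ> s" y] r(1) by (simp add: strict_mono_o o_assoc)
  then have "\<forall>\<^sub>F n in sequentially. dist (x (r (s n))) z < e"
    using e(1) by (auto simp: tendsto_iff)
  then obtain n where "dist (x (r (s n))) z < e"
    by (auto simp: eventually_sequentially)
  then show False
    using r(2)[of "s n"] by simp
qed

section \<open>The step-size rule\<close>

locale adaptive_gradient_descent =
  fixes f :: "'a::euclidean_space \<Rightarrow> real" and g :: "'a \<Rightarrow> 'a"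
    and x :: "nat \<Rightarrow> 'a" and \<alpha> \<theta> :: "nat \<Rightarrow> real"
  assumes convex: "convex_on UNIV f"
    and gradient: "\<And>y. GDERIV f y :> g y"
    and loc_lip: "locally_lipschitz g"
    and \<alpha>0: "\<alpha> 0 > 0"
    and run: "adaptive_gd g x \<alpha> \<theta>"
    and distinct: "\<And>k. x (Suc k) \<noteq> x k"
begin

abbreviation "L \<equiv> local_curvature g x"

lemma tangent: "f u + inner (g u) (v - u) \<le> f v"
  by (rule convex_gradient_le[OF convex gradient])

lemma \<theta>_0: "\<theta> 0 = 1 / 3"
  using run by (simp add: adaptive_gd_def)

lemma x_Suc: "x (Suc k) = x k - \<alpha> k *\<^sub>R g (x k)"
  using run by (cases k) (auto simp: adaptive_gd_def)

lemma \<theta>_Suc: "\<theta> (Suc k) = \<alpha> (Suc k) / \<alpha> k"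
  using run by (auto simp: adaptive_gd_def)

lemma \<alpha>_Suc_ereal:
  "ereal (\<alpha> (Suc k)) =
     min (ereal (sqrt (2 / 3 + \<theta> k) * \<alpha> k))
         (ereal (\<alpha> k) / ereal (sqrt (max (2 * (\<alpha> k)\<^sup>2 * (L (Suc k))\<^sup>2 - 1) 0)))"
proof -
  have "Suc k \<ge> 1" by simp
  with run show ?thesis unfolding adaptive_gd_def by (metis diff_Suc_1)
qed

text \<open>For positive \<open>\<alpha> k\<close> the quotient by 0 is infinite, so the second
  candidate drops out when \<open>D \<le> 0\<close>.\<close>

lemma \<alpha>_Suc:
  assumes "\<alpha> k > 0"
  shows "\<alpha> (Suc k) =
    (let D = 2 * (\<alpha> k)\<^sup>2 * (L (Suc k))\<^sup>2 - 1
     in if D \<le> 0 then sqrt (2 / 3 + \<theta> k) * \<alpha> k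
        else min (sqrt (2 / 3 + \<theta> k) * \<alpha> k) (\<alpha> k / sqrt D))"
proof (cases "2 * (\<alpha> k)\<^sup>2 * (L (Suc k))\<^sup>2 - 1 \<le> 0")
  case True
  then show ?thesis
    using \<alpha>_Suc_ereal[of k] assms by (simp add: Let_def max_def)
next
  case False
  then show ?thesis
    using \<alpha>_Suc_ereal[of k] assms
    by (simp add: Let_def max_def flip: ereal_min)
qed

text \<open>Proved jointly: the real form of the rule needs \<open>\<alpha> k > 0\<close>, and
  positivity of its first candidate needs the sign of \<open>\<theta> k\<close>.\<close>

lemma \<alpha>\<theta>_pos: "\<alpha> k > 0 \<and> \<theta> k > 0"
proof (induction k)
  case 0
  then show ?case using \<alpha>0 \<theta>_0 by simp
next
  case (Suc k)
  then show ?case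
    by (auto simp: \<theta>_Suc \<alpha>_Suc Let_def)
qed

lemma \<alpha>_pos: "\<alpha> k > 0" and \<theta>_pos: "\<theta> k > 0"
  using \<alpha>\<theta>_pos by auto

lemma \<alpha>_Suc_le: "\<alpha> (Suc k) \<le> sqrt (2 / 3 + \<theta> k) * \<alpha> k"
  using \<alpha>_Suc[OF \<alpha>_pos, of k] by (auto simp: Let_def)

lemma \<theta>_Suc_sq_le: "(\<theta> (Suc k))\<^sup>2 \<le> 2 / 3 + \<theta> k"
proof -
  have "\<theta> (Suc k) \<le> sqrt (2 / 3 + \<theta> k)"
    using \<alpha>_Suc_le[of k] \<alpha>_pos[of k] by (simp add: \<theta>_Suc pos_divide_le_eq)
  then have "(\<theta> (Suc k))\<^sup>2 \<le> (sqrt (2 / 3 + \<theta> k))\<^sup>2"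
    using \<theta>_pos[of "Suc k"] by (intro power_mono) auto
  then show ?thesis using \<theta>_pos[of k] by simp
qed

text \<open>The equation is the squared second candidate; it will bound unscaled steps from
  below.\<close>

lemma \<alpha>_Suc_alternatives:
  "\<alpha> (Suc k) = sqrt (2 / 3 + \<theta> k) * \<alpha> k \<or>
   (\<alpha> (Suc k))\<^sup>2 * (2 * (\<alpha> k)\<^sup>2 * (L (Suc k))\<^sup>2 - 1) = (\<alpha> k)\<^sup>2"
  using \<alpha>_Suc[OF \<alpha>_pos, of k]
  by (auto simp: Let_def min_def power_divide split: if_splits)

lemma \<alpha>_Suc_curvature_le:
  "(\<alpha> (Suc k))\<^sup>2 * (2 * (\<alpha> k)\<^sup>2 * (L (Suc k))\<^sup>2 - 1) \<le> (\<alpha> k)\<^sup>2"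
proof (cases "2 * (\<alpha> k)\<^sup>2 * (L (Suc k))\<^sup>2 - 1 \<le> 0")
  case True
  then have "(\<alpha> (Suc k))\<^sup>2 * (2 * (\<alpha> k)\<^sup>2 * (L (Suc k))\<^sup>2 - 1) \<le> 0"
    by (intro mult_nonneg_nonpos) auto
  then show ?thesis by (meson order_trans zero_le_power2)
next
  case False
  define D where "D = 2 * (\<alpha> k)\<^sup>2 * (L (Suc k))\<^sup>2 - 1"
  have D: "D > 0" using False by (simp add: D_def)
  have "\<alpha> (Suc k) \<le> \<alpha> k / sqrt D"
    using \<alpha>_Suc[OF \<alpha>_pos, of k] D by (simp add: Let_def flip: D_def)
  then have "(\<alpha> (Suc k))\<^sup>2 \<le> (\<alpha> k / sqrt D)\<^sup>2"
    using \<alpha>_pos[of "Suc k"] by (intro power_mono) auto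
  then show ?thesis
    using D by (simp add: power_divide pos_le_divide_eq flip: D_def)
qed

section \<open>The energy estimate\<close>

lemma gradient_diff_norm:
  "(norm (g (x (Suc k)) - g (x k)))\<^sup>2 = (L (Suc k))\<^sup>2 * (\<alpha> k)\<^sup>2 * (norm (g (x k)))\<^sup>2"
proof -
  have "norm (g (x (Suc k)) - g (x k)) = L (Suc k) * norm (x (Suc k) - x k)"
    using distinct[of k] by (simp add: local_curvature_def)
  also have "norm (x (Suc k) - x k) = \<alpha> k * norm (g (x k))"
    using \<alpha>_pos[of k] by (simp add: x_Suc)
  finally show ?thesis by (simp add: power_mult_distrib)
qed

text \<open>Expanding the squared gradient difference expresses \<open>M\<close> through
  \<open>N\<close>, \<open>P\<close> and the curvature. The step-size rule absorbs the curvature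
  term, and convexity bounds the remaining \<open>4 * P - N\<close>.\<close>

lemma gradient_norm_Suc_le:
  "2 * (\<alpha> (Suc k))\<^sup>2 * (norm (g (x (Suc k))))\<^sup>2
     \<le> (\<alpha> k)\<^sup>2 * (norm (g (x k)))\<^sup>2
        + 3 * \<alpha> (Suc k) * \<theta> (Suc k) * (f (x k) - f (x (Suc k)))"
proof -
  define a where "a = \<alpha> k"
  define b where "b = \<alpha> (Suc k)"
  define N where "N = (norm (g (x k)))\<^sup>2"
  define M where "M = (norm (g (x (Suc k))))\<^sup>2"
  define P where "P = inner (g (x (Suc k))) (g (x k))"
  define G where "G = f (x k) - f (x (Suc k))"
  have ab: "a > 0" "b > 0" by (simp_all add: a_def b_def \<alpha>_pos)
  have "(L (Suc k))\<^sup>2 * a\<^sup>2 * N = M + N - 2 * P"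
    unfolding a_def N_def M_def P_def gradient_diff_norm[symmetric]
    by (simp add: power2_norm_eq_inner inner_diff_left inner_diff_right inner_commute)
  then have "2 * M = (2 * a\<^sup>2 * (L (Suc k))\<^sup>2 - 1) * N - N + 4 * P"
    by (simp add: algebra_simps)
  then have "2 * b\<^sup>2 * M = b\<^sup>2 * (2 * a\<^sup>2 * (L (Suc k))\<^sup>2 - 1) * N - b\<^sup>2 * N + 4 * b\<^sup>2 * P"
    by algebra
  moreover have "b\<^sup>2 * (2 * a\<^sup>2 * (L (Suc k))\<^sup>2 - 1) * N \<le> a\<^sup>2 * N"
    unfolding a_def b_def by (intro mult_right_mono \<alpha>_Suc_curvature_le) (simp add: N_def)
  \<comment> \<open>The tangents at the new and the old iterate give
    \<open>a * P \<le> G \<le> a * N\<close>, hence \<open>4 * P - N \<le> 3 * G / a\<close>; this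
    is the origin of the factor 3.\<close>
  moreover have "b\<^sup>2 / a * (a * P) \<le> b\<^sup>2 / a * G"
    using tangent[of "x (Suc k)" "x k"] ab
    by (intro mult_left_mono) (auto simp: x_Suc P_def G_def a_def)
  moreover have "b\<^sup>2 / a * G \<le> b\<^sup>2 / a * (a * N)"
    using tangent[of "x k" "x (Suc k)"] ab
    by (intro mult_left_mono) (auto simp: x_Suc N_def G_def a_def power2_norm_eq_inner)
  moreover have "b\<^sup>2 / a * (a * P) = b\<^sup>2 * P" "b\<^sup>2 / a * (a * N) = b\<^sup>2 * N"
    using ab by simp_all
  ultimately have "2 * b\<^sup>2 * M \<le> a\<^sup>2 * N + 3 * (b\<^sup>2 / a * G)"
    by argo
  then show ?thesis
    by (simp add: \<theta>_Suc a_def b_def N_def M_def G_def power2_eq_square)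
qed

definition energy :: "'a \<Rightarrow> nat \<Rightarrow> real" where
  "energy z k = (norm (x (Suc k) - z))\<^sup>2 + (\<alpha> k)\<^sup>2 * (norm (g (x k)))\<^sup>2
     + (2 * \<alpha> k + 3 * \<alpha> k * \<theta> k) * (f (x k) - f z)"

text \<open>The coefficient of \<open>f (x k) - f z\<close> that remains when the gradient bound at
  step \<open>Suc k\<close> is paid for by \<open>energy z k\<close>.\<close>

definition weight :: "nat \<Rightarrow> real" where
  "weight k = 2 * \<alpha> k + 3 * \<alpha> k * \<theta> k - 3 * \<alpha> (Suc k) * \<theta> (Suc k)"

lemma weight_nonneg: "weight k \<ge> 0"
proof -
  have "\<alpha> (Suc k) = \<theta> (Suc k) * \<alpha> k"
    using \<alpha>_pos[of k] by (simp add: \<theta>_Suc)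
  then have "weight k = 3 * \<alpha> k * (2 / 3 + \<theta> k - (\<theta> (Suc k))\<^sup>2)"
    by (simp add: weight_def algebra_simps power2_eq_square)
  then show ?thesis
    using \<theta>_Suc_sq_le[of k] \<alpha>_pos[of k] by simp
qed

lemma dist_Suc_sq:
  "(norm (x (Suc k) - z))\<^sup>2 =
     (norm (x k - z))\<^sup>2 - 2 * \<alpha> k * inner (g (x k)) (x k - z) + (\<alpha> k)\<^sup>2 * (norm (g (x k)))\<^sup>2"
proof -
  have "x (Suc k) - z = (x k - z) - \<alpha> k *\<^sub>R g (x k)" by (simp add: x_Suc)
  then show ?thesis
    by (simp only: power2_norm_eq_inner)
       (simp add: inner_diff_left inner_diff_right inner_commute power2_eq_square algebra_simps)
qed

text \<open>The Bregman divergence of \<open>f\<close> between \<open>z\<close> and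
  \<open>x k\<close>. It is kept in the energy estimate because its vanishing later forces the
  gradients to 0.\<close>

definition gap :: "'a \<Rightarrow> nat \<Rightarrow> real" where
  "gap z k = inner (g (x k)) (x k - z) - (f (x k) - f z)"

lemma gap_nonneg: "gap z k \<ge> 0"
  using tangent[of "x k" z] by (simp add: gap_def inner_diff_right)

text \<open>Expanding the distance supplies a second
  \<open>(\<alpha> (Suc k))^2 * (norm (g (x (Suc k))))^2\<close>, matching the factor 2 of the
  gradient bound, and its inner product cancels the \<open>2 * \<alpha> (Suc k)\<close> part of the
  function-value term up to the gap.\<close>

lemma energy_Suc:
  "energy z (Suc k) + weight k * (f (x k) - f z) + 2 * \<alpha> (Suc k) * gap z (Suc k) \<le> energy z k"
  using gradient_norm_Suc_le[of k] unfolding energy_def weight_def gap_def dist_Suc_sq[of "Suc k"]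
  by (simp add: algebra_simps)

text \<open>Since \<open>\<theta> 0 = 1 / 3\<close>, the function-value coefficient is
  \<open>3 * \<alpha> 0\<close>; the inner product from the distance removes
  \<open>2 * \<alpha> 0\<close> of it.\<close>

lemma energy_0:
  "energy z 0 \<le> (norm (x 0 - z))\<^sup>2 + 2 * (\<alpha> 0)\<^sup>2 * (norm (g (x 0)))\<^sup>2 + \<alpha> 0 * (f (x 0) - f z)"
proof -
  have "2 * \<alpha> 0 * gap z 0 \<ge> 0"
    using gap_nonneg \<alpha>_pos[of 0] by simp
  then show ?thesis
    unfolding energy_def dist_Suc_sq[of 0] gap_def by (simp add: \<theta>_0 algebra_simps)
qed

section \<open>The energy relative to a minimizer\<close>

context
  fixes z assumes z: "minimizer f z"
begin

lemma minimizer_le: "f z \<le> f y"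
  using z by (simp add: minimizer_def)

lemma gradient_minimizer: "g z = 0"
proof -
  have "(f has_derivative (\<lambda>h. inner h (g z))) (at z)"
    using gradient[of z] by (simp add: gderiv_def)
  then have "(\<lambda>h. inner h (g z)) = (\<lambda>h. 0)"
    by (rule has_derivative_local_min) (simp add: minimizer_le)
  then have "inner (g z) (g z) = 0" by meson
  then show ?thesis by simp
qed

lemma energy_Suc_le: "energy z (Suc k) + 2 * \<alpha> (Suc k) * gap z (Suc k) \<le> energy z k"
proof -
  have "weight k * (f (x k) - f z) \<ge> 0"
    using weight_nonneg minimizer_le by simp
  with energy_Suc[of z k] show ?thesis by linarith
qed

lemma energy_decreasing: "decseq (energy z)"
proof (rule decseq_SucI)
  fix k
  have "2 * \<alpha> (Suc k) * gap z (Suc k) \<ge> 0"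
    using gap_nonneg \<alpha>_pos[of "Suc k"] by simp
  with energy_Suc_le[of k] show "energy z (Suc k) \<le> energy z k" by linarith
qed

lemma dist_sq_le_energy: "(norm (x (Suc k) - z))\<^sup>2 \<le> energy z k"
  using minimizer_le \<alpha>_pos[of k] \<theta>_pos[of k] by (simp add: energy_def)

lemma energy_nonneg: "energy z k \<ge> 0"
  using dist_sq_le_energy[of k] by (meson order_trans zero_le_power2)

lemma energy_convergent: "convergent (energy z)"
  using energy_decreasing energy_nonneg by (metis convergent_def decseq_convergent)

text \<open>Replacing each function gap by \<open>m\<close> makes the weights telescope. The last
  energy returns the subtracted \<open>3 * \<alpha> k * \<theta> k * m\<close> and contributes the
  summand \<open>2 * \<alpha> k * m\<close>.\<close>

lemma min_gap_sum:
  assumes m: "0 \<le> m" and le: "\<And>i. 1 \<le> i \<Longrightarrow> i \<le> k \<Longrightarrow> m \<le> f (x i) - f z" and k: "k \<ge> 1"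
  shows "m * (2 * (\<Sum>i=1..k. \<alpha> i)) \<le> energy z 0"
proof -
  have "energy z (Suc j) + 2 * m * (\<Sum>i=1..j. \<alpha> i) - 3 * \<alpha> (Suc j) * \<theta> (Suc j) * m \<le> energy z 0"
    if "j < k" for j
    using that
  proof (induction j)
    case 0
    have "3 * \<alpha> (Suc 0) * \<theta> (Suc 0) * m \<ge> 0"
      using \<alpha>_pos[of "Suc 0"] \<theta>_pos[of "Suc 0"] m by simp
    \<comment> \<open>The weight of index 0 is dropped: \<open>m\<close> is a lower bound for the
      gaps from index 1 on only.\<close>
    moreover have "energy z (Suc 0) \<le> energy z 0"
      using energy_decreasing by (simp add: decseqD)
    ultimately have "energy z (Suc 0) - 3 * \<alpha> (Suc 0) * \<theta> (Suc 0) * m \<le> energy z 0"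
      by linarith
    then show ?case by simp
  next
    case (Suc j)
    have "weight (Suc j) * m \<le> weight (Suc j) * (f (x (Suc j)) - f z)"
      using Suc.prems by (intro mult_left_mono le weight_nonneg) auto
    moreover have "2 * \<alpha> (Suc (Suc j)) * gap z (Suc (Suc j)) \<ge> 0"
      using gap_nonneg \<alpha>_pos[of "Suc (Suc j)"] by simp
    ultimately show ?case
      using Suc energy_Suc[of z "Suc j"] by (simp add: weight_def algebra_simps)
  qed
  moreover obtain j where j: "k = Suc j" using k by (cases k) auto
  moreover have "(2 * \<alpha> k + 3 * \<alpha> k * \<theta> k) * m \<le> energy z k"
  proof -
    have "(2 * \<alpha> k + 3 * \<alpha> k * \<theta> k) * m \<le> (2 * \<alpha> k + 3 * \<alpha> k * \<theta> k) * (f (x k) - f z)"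
      using k \<alpha>_pos[of k] \<theta>_pos[of k] by (intro mult_left_mono le) auto
    then show ?thesis by (simp add: energy_def add_increasing)
  qed
  ultimately show ?thesis by (fastforce simp: algebra_simps)
qed

lemma iterates_in_ball:
  assumes "R \<ge> 0"
    and R: "R\<^sup>2 = (norm (x 0 - z))\<^sup>2 + 2 * (\<alpha> 0)\<^sup>2 * (norm (g (x 0)))\<^sup>2 + \<alpha> 0 * (f (x 0) - f z)"
  shows "x k \<in> cball z R"
proof -
  have "(norm (x k - z))\<^sup>2 \<le> R\<^sup>2"
  proof (cases k)
    case 0
    then show ?thesis using R \<alpha>0 minimizer_le[of "x 0"] by simp
  next
    case (Suc j)
    have "energy z j \<le> energy z 0" using energy_decreasing by (simp add: decseqD)
    then show ?thesis using dist_sq_le_energy[of j] energy_0[of z] R Suc by simp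
  qed
  then have "norm (x k - z) \<le> R" using \<open>R \<ge> 0\<close> by (rule power2_le_imp_le)
  then show ?thesis by (simp add: dist_norm norm_minus_commute)
qed

end

section \<open>Step sizes along the iterates\<close>

lemma curvature_le:
  assumes "C-lipschitz_on S g" "\<And>k. x k \<in> S"
  shows "L (Suc k) \<le> C"
  using lipschitz_onD[OF assms(1) assms(2) assms(2), of "Suc k" k] distinct[of k]
  by (simp add: local_curvature_def dist_norm pos_divide_le_eq)

text \<open>An unscaled step satisfies \<open>a^2 + b^2 = 2 * a^2 * b^2 * (L (Suc k))^2\<close>;
  dropping \<open>b^2\<close> and cancelling \<open>a^2\<close> leaves
  \<open>1 \<le> 2 * b^2 * C^2\<close>.\<close>

lemma \<alpha>_Suc_lower:
  assumes "L (Suc k) \<le> C" "C > 0"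
  shows "\<alpha> (Suc k) = sqrt (2 / 3 + \<theta> k) * \<alpha> k \<or> 1 / (sqrt 2 * C) \<le> \<alpha> (Suc k)"
proof (unfold disj_imp, rule impI)
  define a where "a = \<alpha> k"
  define b where "b = \<alpha> (Suc k)"
  assume "\<alpha> (Suc k) \<noteq> sqrt (2 / 3 + \<theta> k) * \<alpha> k"
  then have eq: "b\<^sup>2 * (2 * a\<^sup>2 * (L (Suc k))\<^sup>2 - 1) = a\<^sup>2"
    using \<alpha>_Suc_alternatives[of k] by (simp add: a_def b_def)
  have ab: "a > 0" "b > 0" by (simp_all add: a_def b_def \<alpha>_pos)
  have "L (Suc k) \<ge> 0" by (simp add: local_curvature_def)
  then have "(L (Suc k))\<^sup>2 \<le> C\<^sup>2" using assms by (intro power_mono) auto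
  then have *: "2 * a\<^sup>2 * b\<^sup>2 * (L (Suc k))\<^sup>2 \<le> 2 * a\<^sup>2 * b\<^sup>2 * C\<^sup>2"
    by (intro mult_left_mono) auto
  have "a\<^sup>2 * 1 \<le> a\<^sup>2 * (2 * b\<^sup>2 * C\<^sup>2)"
  proof -
    have "a\<^sup>2 + b\<^sup>2 = 2 * a\<^sup>2 * b\<^sup>2 * (L (Suc k))\<^sup>2" using eq by (simp add: algebra_simps)
    then have "a\<^sup>2 \<le> 2 * a\<^sup>2 * b\<^sup>2 * C\<^sup>2"
      using * zero_le_power2[of b] by linarith
    then show ?thesis by (simp add: algebra_simps)
  qed
  then have "1\<^sup>2 \<le> (sqrt 2 * C * b)\<^sup>2"
    using ab by (simp add: power_mult_distrib algebra_simps)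
  then have "1 \<le> sqrt 2 * C * b"
    using ab assms by (intro power2_le_imp_le[of 1]) auto
  then show "1 / (sqrt 2 * C) \<le> \<alpha> (Suc k)"
    using assms by (simp add: b_def field_simps)
qed

text \<open>Starting data for the averaged step-size bound. As
  \<open>sqrt (2 / 3 + \<theta> 0) = 1\<close>, the lower end of the interval passes from
  \<open>\<alpha> 0\<close> to \<open>\<alpha> 1\<close>; the upper end gives
  \<open>sqrt (2 * t^2 - 1) \<le> 3\<close>, hence a ratio of at least 1/3.\<close>

lemma first_step:
  assumes "\<alpha> 0 * L 1 \<in> {1 / sqrt 2..2}"
  shows "1 / (sqrt 2 * L 1) \<le> \<alpha> 1" "1 / 3 \<le> \<theta> 1" "L 1 > 0"
proof -
  define t where "t = \<alpha> 0 * L 1"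
  have t: "1 / sqrt 2 \<le> t" "t \<le> 2" using assms by (auto simp: t_def)
  have "0 < 1 / sqrt (2::real)" by simp
  then have "t > 0" using t by linarith
  then show L1: "L 1 > 0" using \<alpha>0 by (simp add: t_def zero_less_mult_iff)
  have "1 / (sqrt 2 * L 1) \<le> \<alpha> 0"
    using t(1) L1 by (simp add: t_def field_simps)
  then show "1 / (sqrt 2 * L 1) \<le> \<alpha> 1"
    using \<alpha>_Suc_lower[of 0 "L 1"] L1 \<theta>_0 by auto
  show "1 / 3 \<le> \<theta> 1"
  proof -
    have "2 * t\<^sup>2 - 1 \<le> 9"
      using power_mono[OF t(2), of 2] \<open>t > 0\<close> by simp
    then have "sqrt (2 * t\<^sup>2 - 1) \<le> 3"
      by (intro real_le_lsqrt) auto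
    then have "1 / 3 \<le> 1 / sqrt (2 * t\<^sup>2 - 1)" if "2 * t\<^sup>2 - 1 > 0"
      using that by (intro divide_left_mono) auto
    moreover have "\<theta> 1 = (if 2 * t\<^sup>2 - 1 \<le> 0 then 1 else min 1 (1 / sqrt (2 * t\<^sup>2 - 1)))"
    proof -
      have "2 * (\<alpha> 0)\<^sup>2 * (L 1)\<^sup>2 - 1 = 2 * t\<^sup>2 - 1" "sqrt (2 / 3 + \<theta> 0) = 1"
        by (simp_all add: t_def power_mult_distrib \<theta>_0)
      then show ?thesis
        using \<alpha>_Suc[of 0] \<alpha>0 \<theta>_Suc[of 0]
        unfolding One_nat_def Let_def by (simp only:) (simp add: min_def field_simps)
    qed
    ultimately show ?thesis
      by (cases "2 * t\<^sup>2 - 1 > 0") (simp_all add: min_def pos_le_divide_eq)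
  qed
qed

section \<open>Convergence of the iterates\<close>

lemma converges:
  assumes "\<exists>z. minimizer f z"
  shows "\<exists>z. minimizer f z \<and> x \<longlonglongrightarrow> z"
proof -
  obtain z0 where z0: "minimizer f z0" using assms by blast
  define E where "E = (norm (x 0 - z0))\<^sup>2 + 2 * (\<alpha> 0)\<^sup>2 * (norm (g (x 0)))\<^sup>2
    + \<alpha> 0 * (f (x 0) - f z0)"
  have "E \<ge> 0"
    unfolding E_def using minimizer_le[OF z0, of "x 0"] \<alpha>0
    by (intro add_nonneg_nonneg mult_nonneg_nonneg) auto
  then have R: "sqrt E \<ge> 0"
    "(sqrt E)\<^sup>2 = (norm (x 0 - z0))\<^sup>2 + 2 * (\<alpha> 0)\<^sup>2 * (norm (g (x 0)))\<^sup>2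
    + \<alpha> 0 * (f (x 0) - f z0)"
    by (simp_all flip: E_def)
  note ball = iterates_in_ball[OF z0 R]
  obtain C0 where C0: "C0-lipschitz_on (cball z0 (sqrt E)) g"
    using loc_lip[unfolded locally_lipschitz_def, rule_format, OF compact_cball] by auto
  \<comment> \<open>A Lipschitz constant may be 0, but \<open>C\<close> has to be a divisor.\<close>
  define C where "C = max C0 1"
  have C: "C > 0" "C-lipschitz_on (cball z0 (sqrt E)) g"
    unfolding C_def by (simp, rule lipschitz_on_le[OF C0], simp)
  \<comment> \<open>The initial step is arbitrary and may lie below the bound from the
    curvature.\<close>
  define m where "m = min (\<alpha> 0) (1 / (sqrt 2 * C))"
  have m: "m > 0" using C \<alpha>0 by (simp add: m_def)
  have \<alpha>_ge: "4 / 5 * m \<le> \<alpha> k" for k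
  proof (rule step_sizes_lower_bound[of m \<alpha> \<theta>])
    fix k
    show "\<alpha> (Suc k) = sqrt (2 / 3 + \<theta> k) * \<alpha> k \<or> m \<le> \<alpha> (Suc k)"
      using \<alpha>_Suc_lower[OF curvature_le[OF C(2) ball] C(1), of k] by (auto simp: m_def)
  qed (use m \<alpha>_pos \<theta>_pos \<theta>_Suc in \<open>auto simp: m_def\<close>)

  have grad_0: "(\<lambda>k. g (x (Suc k))) \<longlonglongrightarrow> 0"
  proof -
    define q where "q = 2 * (4 / 5 * m) / (4 * C)"
    have q: "q > 0" using m C by (simp add: q_def)
    have "q * (norm (g (x (Suc k))))\<^sup>2 \<le> energy z0 k - energy z0 (Suc k)" for k
    proof -
      have "(norm (g (x (Suc k))))\<^sup>2 / (4 * C) \<le> gap z0 (Suc k)"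
        unfolding gap_def
        by (rule convex_gradient_gap[OF convex gradient C(2,1) gradient_minimizer[OF z0] ball])
      then have "2 * (4 / 5 * m) * ((norm (g (x (Suc k))))\<^sup>2 / (4 * C))
          \<le> 2 * \<alpha> (Suc k) * gap z0 (Suc k)"
        using \<alpha>_ge[of "Suc k"] m C \<alpha>_pos[of "Suc k"] by (intro mult_mono) auto
      with energy_Suc_le[OF z0, of k] show ?thesis by (simp add: q_def)
    qed
    then have bound: "(norm (g (x (Suc k))))\<^sup>2 \<le> (energy z0 k - energy z0 (Suc k)) / q" for k
      using q by (simp add: pos_le_divide_eq mult.commute)
    obtain l where l: "energy z0 \<longlonglongrightarrow> l"
      using energy_convergent[OF z0] by (auto simp: convergent_def)
    have "(\<lambda>k. (energy z0 k - energy z0 (Suc k)) / q) \<longlonglongrightarrow> (l - l) / q"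
      using q by (intro tendsto_intros l LIMSEQ_Suc) auto
    then have "(\<lambda>k. (norm (g (x (Suc k))))\<^sup>2) \<longlonglongrightarrow> 0"
      by (intro tendsto_sandwich[OF _ always_eventually[OF allI[OF bound]] tendsto_const])
        simp_all
    from tendsto_real_sqrt[OF this] show ?thesis
      by (simp add: tendsto_norm_zero_iff)
  qed
  then have grad_0: "(\<lambda>k. g (x k)) \<longlonglongrightarrow> 0"
    by (rule LIMSEQ_imp_Suc)

  have bdd: "bounded (range x)"
    using ball by (intro bounded_subset[OF bounded_cball]) auto

  have cluster: "minimizer f y" if r: "strict_mono r" and y: "(x \<circ> r) \<longlonglongrightarrow> y" for r y
  proof -
    have "(\<lambda>k. f (x (r k))) \<longlonglongrightarrow> f y"
      using isCont_tendsto_compose[OF gderiv_imp_continuous[OF gradient] y] by (simp add: o_def)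
    moreover have "(\<lambda>k. f z0 + inner (g (x (r k))) (x (r k) - z0)) \<longlonglongrightarrow> f z0 + inner 0 (y - z0)"
      using LIMSEQ_subseq_LIMSEQ[OF grad_0 r] y by (intro tendsto_intros) (auto simp: o_def)
    \<comment> \<open>A nonnegative gap bounds \<open>f (x (r k))\<close> by \<open>f z0\<close>
      plus a term that vanishes in the limit.\<close>
    moreover have "f (x (r k)) \<le> f z0 + inner (g (x (r k))) (x (r k) - z0)" for k
      using gap_nonneg[of z0 "r k"] by (simp add: gap_def)
    ultimately have "f y \<le> f z0 + inner 0 (y - z0)"
      by (intro LIMSEQ_le) auto
    then have "f y \<le> f w" for w
      using minimizer_le[OF z0, of w] by simp
    then show ?thesis by (simp add: minimizer_def)
  qed

  have unique: "y = y'"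
    if r: "strict_mono r" "(x \<circ> r) \<longlonglongrightarrow> y" and s: "strict_mono s" "(x \<circ> s) \<longlonglongrightarrow> y'" for r s y y'
  proof -
    note y = cluster[OF r] and y' = cluster[OF s]
    have "f y = f y'" using minimizer_le[OF y, of y'] minimizer_le[OF y', of y] by simp
    \<comment> \<open>The part of the energy that is independent of the minimizer need not vanish, since the
      step sizes may be unbounded; it cancels in the difference.\<close>
    then have "energy y k - energy y' k
        = (norm y)\<^sup>2 - (norm y')\<^sup>2 - 2 * inner (x (Suc k)) (y - y')" for k
      by (simp add: energy_def power2_norm_eq_inner inner_diff_left inner_diff_right inner_commute)
    then have inner_eq: "inner (x (Suc k)) (y - y')
        = ((norm y)\<^sup>2 - (norm y')\<^sup>2 - (energy y k - energy y' k)) / 2" for k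
      by simp
    obtain l l' where "energy y \<longlonglongrightarrow> l" "energy y' \<longlonglongrightarrow> l'"
      using energy_convergent[OF y] energy_convergent[OF y'] unfolding convergent_def by blast
    then have "(\<lambda>k. inner (x (Suc k)) (y - y')) \<longlonglongrightarrow> ((norm y)\<^sup>2 - (norm y')\<^sup>2 - (l - l')) / 2"
      unfolding inner_eq by (intro tendsto_intros) auto
    then obtain c where c: "(\<lambda>k. inner (x k) (y - y')) \<longlonglongrightarrow> c"
      using LIMSEQ_imp_Suc[of "\<lambda>k. inner (x k) (y - y')"] by blast
    \<comment> \<open>The limit \<open>c\<close> exists along the whole sequence, so all cluster
      points have the same inner product with \<open>y - y'\<close>, in particular \<open>y\<close>
      and \<open>y'\<close> themselves.\<close>
    have "inner w (y - y') = c" if "strict_mono p" "(x \<circ> p) \<longlonglongrightarrow> w" for p w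
    proof (rule LIMSEQ_unique)
      show "(\<lambda>k. inner ((x \<circ> p) k) (y - y')) \<longlonglongrightarrow> inner w (y - y')"
        using that by (intro tendsto_intros)
      show "(\<lambda>k. inner ((x \<circ> p) k) (y - y')) \<longlonglongrightarrow> c"
        using LIMSEQ_subseq_LIMSEQ[OF c that(1)] by (simp add: o_def)
    qed
    then have "inner y (y - y') = inner y' (y - y')" using r s by simp
    then have "inner (y - y') (y - y') = 0" by (simp add: inner_diff_left)
    then show ?thesis by simp
  qed

  obtain z r where zr: "strict_mono r" "(x \<circ> r) \<longlonglongrightarrow> z"
    using bounded_imp_convergent_subsequence[OF bdd] by blast
  have "x \<longlonglongrightarrow> z"
    by (rule bounded_unique_cluster_imp_tendsto[OF bdd unique[OF _ _ zr]])
  with cluster[OF zr] show ?thesis by blast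
qed

section \<open>Convergence rates\<close>

lemma min_gap_le:
  assumes z: "minimizer f z" and k: "k \<ge> 1"
  shows "Min ((\<lambda>i. f (x i) - f z) ` {1..k}) * (2 * (\<Sum>i=1..k. \<alpha> i))
      \<le> (norm (x 0 - z))\<^sup>2 + 2 * (\<alpha> 0)\<^sup>2 * (norm (g (x 0)))\<^sup>2 + \<alpha> 0 * (f (x 0) - f z)"
proof -
  have "0 \<le> Min ((\<lambda>i. f (x i) - f z) ` {1..k})"
    using k minimizer_le[OF z] by (subst Min_ge_iff) auto
  then show ?thesis
    by (rule order_trans[OF min_gap_sum[OF z _ _ k] energy_0]) (auto intro: Min_le)
qed

lemma sum_\<alpha>_pos: "k \<ge> 1 \<Longrightarrow> 0 < (\<Sum>i=1..k. \<alpha> i)"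
  using \<alpha>_pos by (intro sum_pos) auto

lemma sum_\<alpha>_lower:
  assumes C: "\<And>k. L (Suc k) \<le> C" and first: "\<alpha> 0 * L 1 \<in> {1 / sqrt 2..2}"
  shows "real k * (1 / (sqrt 2 * C)) \<le> (\<Sum>i=1..k. \<alpha> i)"
proof (rule step_sizes_sum_lower_bound[of _ \<alpha> \<theta>])
  note L1 = first_step[OF first]
  have L1C: "L 1 \<le> C" using C[of 0] by simp
  then show "1 / (sqrt 2 * C) > 0" using L1(3) by simp
  have "1 / (sqrt 2 * C) \<le> 1 / (sqrt 2 * L 1)"
    using L1(3) L1C by (intro divide_left_mono mult_left_mono mult_pos_pos) auto
  then show "1 / (sqrt 2 * C) \<le> \<alpha> 1" using L1(1) by linarith
  show "\<alpha> (Suc k) = sqrt (2 / 3 + \<theta> k) * \<alpha> k \<or> 1 / (sqrt 2 * C) \<le> \<alpha> (Suc k)" for k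
    using \<alpha>_Suc_lower[OF C] L1(3) L1C by auto
qed (use \<alpha>_pos \<theta>_pos \<theta>_Suc first_step[OF first] in auto)

text \<open>Every Lipschitz constant on \<open>S\<close> bounds the curvature, hence so does their
  infimum, whether or not it is attained.\<close>

lemma curvature_le_lipschitz_const:
  assumes "compact S" "\<And>k. x k \<in> S"
  shows "L (Suc k) \<le> lipschitz_const S g"
  unfolding lipschitz_const_def
proof (rule cInf_greatest)
  show "{C. C-lipschitz_on S g} \<noteq> {}"
    using loc_lip assms(1) by (auto simp: locally_lipschitz_def)
qed (use curvature_le[OF _ assms(2)] in auto)

end

theorem theorem2:
  fixes f :: "real ^ 'd \<Rightarrow> real" and g :: "real ^ 'd \<Rightarrow> real ^ 'd"
    and x :: "nat \<Rightarrow> real ^ 'd" and \<alpha> \<theta> :: "nat \<Rightarrow> real" and fstar :: real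
  assumes "convex_on UNIV f"
    and "\<And>y. GDERIV f y :> g y"
    and "locally_lipschitz g"
    and "\<exists>z. minimizer f z"
    and "fstar = (INF y. f y)"
    and "\<alpha> 0 > 0"
    and "adaptive_gd g x \<alpha> \<theta>"
    and "\<And>k. k \<ge> 1 \<Longrightarrow> x k \<noteq> x (k - 1)"
  shows "(\<exists>z. minimizer f z \<and> x \<longlonglongrightarrow> z) \<and>
    (\<forall>xstar R. minimizer f xstar \<and> R \<ge> 0 \<and>
        R\<^sup>2 = (norm (x 0 - xstar))\<^sup>2 + 2 * (\<alpha> 0)\<^sup>2 * (norm (g (x 0)))\<^sup>2 + \<alpha> 0 * (f (x 0) - fstar) \<longrightarrow>
        (\<forall>k\<ge>1. Min ((\<lambda>i. f (x i) - fstar) ` {1..k}) \<le> R\<^sup>2 / (2 * (\<Sum>i=1..k. \<alpha> i))) \<and>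
        (\<alpha> 0 * local_curvature g x 1 \<in> {1 / sqrt 2..2} \<longrightarrow>
          (\<forall>k\<ge>1. Min ((\<lambda>i. f (x i) - fstar) ` {1..k})
                    \<le> lipschitz_const (cball xstar R) g * R\<^sup>2 / (sqrt 2 * real k))))"
proof -
  have "x (Suc k) \<noteq> x k" for k
    using assms(8)[of "Suc k"] by simp
  then interpret adaptive_gradient_descent f g x \<alpha> \<theta>
    using assms by unfold_locales auto
  have rate: "Min ((\<lambda>i. f (x i) - fstar) ` {1..k}) \<le> R\<^sup>2 / (2 * (\<Sum>i=1..k. \<alpha> i))"
    if z: "minimizer f z" and k: "k \<ge> 1"
      and R: "R\<^sup>2 = (norm (x 0 - z))\<^sup>2 + 2 * (\<alpha> 0)\<^sup>2 * (norm (g (x 0)))\<^sup>2 + \<alpha> 0 * (f (x 0) - fstar)"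
    for z R k
    using min_gap_le[OF z k] sum_\<alpha>_pos[OF k] minimizer_eq_INF[OF z] R assms(5)
    by (simp add: pos_le_divide_eq)
  have rate': "Min ((\<lambda>i. f (x i) - fstar) ` {1..k})
      \<le> lipschitz_const (cball z R) g * R\<^sup>2 / (sqrt 2 * real k)"
    if z: "minimizer f z" and k: "k \<ge> 1" and R0: "R \<ge> 0"
      and R: "R\<^sup>2 = (norm (x 0 - z))\<^sup>2 + 2 * (\<alpha> 0)\<^sup>2 * (norm (g (x 0)))\<^sup>2 + \<alpha> 0 * (f (x 0) - fstar)"
      and first: "\<alpha> 0 * L 1 \<in> {1 / sqrt 2..2}"
    for z R k
  proof -
    define C where "C = lipschitz_const (cball z R) g"
    have ball: "x j \<in> cball z R" for j
      using R minimizer_eq_INF[OF z] assms(5) by (intro iterates_in_ball[OF z R0]) simp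
    have C: "L (Suc j) \<le> C" for j
      unfolding C_def by (rule curvature_le_lipschitz_const[OF compact_cball ball])
    \<comment> \<open>The lower end of the interval for \<open>\<alpha> 0 * L 1\<close> makes
      \<open>L 1\<close>, and with it \<open>C\<close>, positive.\<close>
    have "C > 0" using first_step(3)[OF first] C[of 0] by simp
    have "R\<^sup>2 / (2 * (\<Sum>i=1..k. \<alpha> i)) \<le> R\<^sup>2 / (2 * (real k * (1 / (sqrt 2 * C))))"
      using sum_\<alpha>_lower[OF C first, of k] sum_\<alpha>_pos[OF k] k \<open>C > 0\<close>
      by (intro divide_left_mono mult_left_mono mult_pos_pos) auto
    also have "\<dots> = C * R\<^sup>2 / (sqrt 2 * real k)"
      using \<open>C > 0\<close> k by (simp add: field_simps)
    finally show ?thesis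
      using rate[OF z k R] by (simp add: C_def)
  qed
  show ?thesis
    using converges[OF assms(4)] rate rate' by blast
qed

end
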